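(* Let $\gamma,s,\varepsilon>0$. Let $(X,\rho,\mu)$ be a space of homogeneous type with a lower dimension $d>0$ and an upper dimension $D>0$. Let $\{p_t\}_{t>0}$ be a heat kernel on $X$ with generator $\mathcal L$, and let $K_s$ be the kernel of the fractional operator $\mathcal L^{-s}$. Let $\Phi_1,\Phi_2,\Phi_3:[0,\infty)\to[0,\infty)$ be (measurable) functions. Then the following statements hold: (i) If $p_t(x,y)\lesssim\frac{1}{V(x,t^\gamma)}\Phi_1\big(\frac{\rho(x,y)}{t^\gamma}\big)$ for all $x,y\in X$, $t>0$, and $$\int_0^1\Phi_1(w)w^{d-\frac s\gamma}\frac{dw}{w}+\int_1^\infty\Phi_1(w)w^{D-\frac s\gamma}\frac{dw}{w}<\infty,$$ then $K_s(x,y)\lesssim\frac{\rho(x,y)^{s/\gamma}}{V(x,y)}$ for all $x,y\in X$ with $x\neq y$. (ii) If $p_t(x,y)\gtrsim\frac{1}{V(x,t^\gamma)}\Phi_2\big(\frac{\rho(x,y)}{t^\gamma}\big)$ for all $x,y\in X$, $t>0$, and $\Phi_2$ is non-zero in a set of positive (Lebesgue) measure, then $K_s(x,y)\gtrsim\frac{\rho(x,y)^{s/\gamma}}{V(x,y)}$ for all $x,y\in X$ with $x\ne y$. (iii) If $$|p_t(x,y)-p_t(x',y)|+|p_t(y,x)-p_t(y,x')|\lesssim\frac{1}{V(x,t^\gamma)}\Big(\frac{\rho(x,x')}{t^\gamma}\Big)^{\varepsilon}\Phi_3\Big(\frac{\rho(x,y)}{t^\gamma}\Big)$$ for all $t>0$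 and all $x,x',y\in X$ with $\rho(x,x')<(2A_0)^{-1}\rho(x,y)$, and $$\int_0^1\Phi_3(w)w^{d+\varepsilon-\frac s\gamma}\frac{dw}{w}+\int_1^\infty\Phi_3(w)w^{D+\varepsilon-\frac s\gamma}\frac{dw}{w}<\infty,$$ then for $\rho(x,x')<(2A_0)^{-1}\rho(x,y)$, $$|K_s(x,y)-K_s(x',y)|+|K_s(y,x)-K_s(y,x')|\lesssim\frac{\rho(x,y)^{s/\gamma}}{V(x,y)}\Big(\frac{\rho(x,x')}{\rho(x,y)}\Big)^\varepsilon.$$
   Context: A space of homogeneous type $(X,\rho,\mu)$ is a set $X$ with a quasi-metric $\rho:X\times X\to[0,\infty)$ (that is, $\rho(x,y)=\rho(y,x)$; $\rho(x,y)=0$ iff $x=y$; and $\rho(x,y)\le A_0[\rho(x,z)+\rho(z,y)]$ for some constant $A_0\ge1$) and a positive Borel measure $\mu$ with the doubling property $0<\mu(2B)\le C\mu(B)<\infty$ for all balls $B$, where $B(x,r)=\{y:\rho(x,y)<r\}$ and $2B$ has the same centre and twice the radius. Write $V(x,r)=\mu(B(x,r))$ and $V(x,y)=V(x,\rho(x,y))$ for $x\ne y$. Upper dimension $D>0$: there is $C_\mu\ge1$ with $V(x,R)/V(x,r)\le C_\mu(R/r)^D$ for all $x$, $0<r\le R<\infty$. Lower dimension $d>0$: there is $c>0$ with $V(x,R)/V(x,r)\ge c(R/r)^d$ for all $x$, $0<r\le R<\infty$. A heat kernel is a family $\{p_t\}_{t>0}$ of measurable functions on $X\times X$ such that for all $s,t>0$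 and almost all $x,y$: $p_t(x,y)\ge0$; $\int_Xp_t(x,y)d\mu(y)=1$; $p_t(x,y)=p_t(y,x)$; $p_{s+t}(x,y)=\int_Xp_s(x,z)p_t(z,y)d\mu(z)$; and $\int_Xp_t(\cdot,y)f(y)d\mu(y)\to f$ in $L^2(X,\mu)$ as $t\to0^+$ for all $f\in L^2(X,\mu)$. It is the kernel of an operator written $e^{-t\mathcal L}$, where $\mathcal Lf=\lim_{t\to0}(f-e^{-t\mathcal L}f)/t$ (limit in $L^2$, for those $f$ for which it exists). For $s>0$, $\mathcal L^{-s}f(x)=\frac{1}{\Gamma(s)}\int_0^\infty e^{-t\mathcal L}f(x)\frac{dt}{t^{1-s}}$, and its kernel is $K_s(x,y)=\frac{1}{\Gamma(s)}\int_0^\infty p_t(x,y)\frac{dt}{t^{1-s}}$ (with values in $[0,\infty]$; in (iii) the values of $K_s$ appearing in the differences are understood to be finite). $X\lesssim Y$ means $X\le CY$ with a constant $C>0$ independent of $x,x',y,t$. *)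

theory Defs
  imports "HOL-Analysis.Analysis"
begin

section \<open>Spaces of homogeneous type\<close>

definition quasi_metric_on :: "'a set \<Rightarrow> ('a \<Rightarrow> 'a \<Rightarrow> real) \<Rightarrow> real \<Rightarrow> bool" where
  "quasi_metric_on X \<rho> A\<^sub>0 \<longleftrightarrow>
     A\<^sub>0 \<ge> 1 \<and>
     (\<forall>x\<in>X. \<forall>y\<in>X. \<rho> x y \<ge> 0) \<and>
     (\<forall>x\<in>X. \<forall>y\<in>X. \<rho> x y = \<rho> y x) \<and>
     (\<forall>x\<in>X. \<forall>y\<in>X. \<rho> x y = 0 \<longleftrightarrow> x = y) \<and>
     (\<forall>x\<in>X. \<forall>y\<in>X. \<forall>z\<in>X. \<rho> x y \<le> A\<^sub>0 * (\<rho> x z + \<rho> z y))"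

definition qball :: "'a set \<Rightarrow> ('a \<Rightarrow> 'a \<Rightarrow> real) \<Rightarrow> 'a \<Rightarrow> real \<Rightarrow> 'a set" where
  "qball X \<rho> x r = {y \<in> X. \<rho> x y < r}"

definition quasi_metric_open :: "'a set \<Rightarrow> ('a \<Rightarrow> 'a \<Rightarrow> real) \<Rightarrow> 'a set \<Rightarrow> bool" where
  "quasi_metric_open X \<rho> U \<longleftrightarrow> U \<subseteq> X \<and> (\<forall>x\<in>U. \<exists>r>0. qball X \<rho> x r \<subseteq> U)"

text \<open>
  The underlying set is \<open>space M\<close>. The balls of a quasi-metric need not be open, nor even Borel,
  so their measurability is a separate requirement. The $\sigma$-algebra of \<open>M\<close> contains the Borel
  sets but may be larger (for instance, completed).
\<close>

definition homogeneous_type :: "'a measure \<Rightarrow> ('a \<Rightarrow> 'a \<Rightarrow> real) \<Rightarrow> real \<Rightarrow> bool" where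
  "homogeneous_type M \<rho> A\<^sub>0 \<longleftrightarrow>
     quasi_metric_on (space M) \<rho> A\<^sub>0 \<and>
     (\<forall>U. quasi_metric_open (space M) \<rho> U \<longrightarrow> U \<in> sets M) \<and>
     (\<forall>x\<in>space M. \<forall>r>0. qball (space M) \<rho> x r \<in> sets M) \<and>
     (\<exists>C::real. \<forall>x\<in>space M. \<forall>r>0.
        0 < emeasure M (qball (space M) \<rho> x (2 * r)) \<and>
        emeasure M (qball (space M) \<rho> x (2 * r))
          \<le> ennreal C * emeasure M (qball (space M) \<rho> x r) \<and>
        ennreal C * emeasure M (qball (space M) \<rho> x r) < \<infinity>)"

definition vol :: "'a measure \<Rightarrow> ('a \<Rightarrow> 'a \<Rightarrow> real) \<Rightarrow> 'a \<Rightarrow> real \<Rightarrow> real" where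
  "vol M \<rho> x r = measure M (qball (space M) \<rho> x r)"

definition has_upper_dimension :: "'a measure \<Rightarrow> ('a \<Rightarrow> 'a \<Rightarrow> real) \<Rightarrow> real \<Rightarrow> bool" where
  "has_upper_dimension M \<rho> D \<longleftrightarrow>
     D > 0 \<and>
     (\<exists>C\<ge>1. \<forall>x\<in>space M. \<forall>r R. 0 < r \<and> r \<le> R \<longrightarrow>
        vol M \<rho> x R / vol M \<rho> x r \<le> C * (R / r) powr D)"

definition has_lower_dimension :: "'a measure \<Rightarrow> ('a \<Rightarrow> 'a \<Rightarrow> real) \<Rightarrow> real \<Rightarrow> bool" where
  "has_lower_dimension M \<rho> d \<longleftrightarrow>
     d > 0 \<and>
     (\<exists>c>0. \<forall>x\<in>space M. \<forall>r R. 0 < r \<and> r \<le> R \<longrightarrow>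
        vol M \<rho> x R / vol M \<rho> x r \<ge> c * (R / r) powr d)"


section \<open>Heat kernels and the kernels of fractional powers\<close>

definition square_integrable :: "'a measure \<Rightarrow> ('a \<Rightarrow> real) \<Rightarrow> bool" where
  "square_integrable M f \<longleftrightarrow> f \<in> borel_measurable M \<and> integrable M (\<lambda>x. (f x)\<^sup>2)"

text \<open>\<open>heat_op M p t\<close> is the operator $e^{-t\mathcal{L}}$ with kernel \<open>p t\<close>.\<close>

definition heat_op :: "'a measure \<Rightarrow> (real \<Rightarrow> 'a \<Rightarrow> 'a \<Rightarrow> real) \<Rightarrow> real \<Rightarrow> ('a \<Rightarrow> real) \<Rightarrow> 'a \<Rightarrow> real" where
  "heat_op M p t f x = (\<integral>y. p t x y * f y \<partial>M)"

definition heat_kernel :: "'a measure \<Rightarrow> (real \<Rightarrow> 'a \<Rightarrow> 'a \<Rightarrow> real) \<Rightarrow> bool" where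
  "heat_kernel M p \<longleftrightarrow>
     (\<forall>t>0. (\<lambda>(x, y). p t x y) \<in> borel_measurable (M \<Otimes>\<^sub>M M)) \<and>
     (\<forall>t>0. AE (x, y) in M \<Otimes>\<^sub>M M. p t x y \<ge> 0) \<and>
     (\<forall>t>0. AE x in M. has_bochner_integral M (\<lambda>y. p t x y) 1) \<and>
     (\<forall>t>0. AE (x, y) in M \<Otimes>\<^sub>M M. p t x y = p t y x) \<and>
     (\<forall>s>0. \<forall>t>0. AE (x, y) in M \<Otimes>\<^sub>M M.
        has_bochner_integral M (\<lambda>z. p s x z * p t z y) (p (s + t) x y)) \<and>
     (\<forall>f. square_integrable M f \<longrightarrow>
        ((\<lambda>t. \<integral>\<^sup>+x. ennreal ((heat_op M p t f x - f x)\<^sup>2) \<partial>M) \<longlongrightarrow> 0) (at_right 0))"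

text \<open>
  The generator $\mathcal{L}$, given by its graph: \<open>(f, g)\<close> belongs to it if
  $(f - e^{-t\mathcal{L}} f)/t$ tends to \<open>g\<close> in $L^2$ as $t$ tends to $0$ from the right. Elements
  of $L^2$ are represented by functions, so \<open>g\<close> is determined only almost everywhere.
\<close>

definition heat_generator ::
    "'a measure \<Rightarrow> (real \<Rightarrow> 'a \<Rightarrow> 'a \<Rightarrow> real) \<Rightarrow> (('a \<Rightarrow> real) \<times> ('a \<Rightarrow> real)) set" where
  "heat_generator M p = {(f, g). square_integrable M f \<and> square_integrable M g \<and>
     ((\<lambda>t. \<integral>\<^sup>+x. ennreal (((f x - heat_op M p t f x) / t - g x)\<^sup>2) \<partial>M) \<longlongrightarrow> 0) (at_right 0)}"

text \<open>
  The kernel $K_s$ of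
  $\mathcal{L}^{-s} = \Gamma(s)^{-1} \int_0^\infty e^{-t\mathcal{L}}\, t^{s-1}\, dt$, with values in
  $[0,\infty]$. A heat kernel is nonnegative only almost everywhere; at exceptional points
  \<open>ennreal\<close> replaces \<open>p t x y\<close> by its positive part.
\<close>

definition frac_kernel :: "(real \<Rightarrow> 'a \<Rightarrow> 'a \<Rightarrow> real) \<Rightarrow> real \<Rightarrow> 'a \<Rightarrow> 'a \<Rightarrow> ennreal" where
  "frac_kernel p s x y =
     ennreal (1 / Gamma s) * (\<integral>\<^sup>+t\<in>{0<..}. ennreal (p t x y / t powr (1 - s)) \<partial>lebesgue)"

end

theory Submission
  imports Defs
begin

text \<open>
  Substituting $w = \rho(x,y)/t^\gamma$ turns the integral over $t$ defining $K_s(x,y)$ into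
  $\gamma^{-1} \rho(x,y)^{s/\gamma}$ times an integral over $w$ against $w^{-s/\gamma-1}\,dw$. The
  dimension hypotheses compare $V(x,r)/V(x,r/w)$ with $w^d$ and $w^D$, with exchanged roles for
  $w \le 1$ and $w \ge 1$ and for upper and lower bounds, so the integral over $w$ no longer
  depends on $x$ and $y$. Part (iii) is the same estimate for $\Phi_3(w) w^\varepsilon$, because
  $\rho(x,x')/t^\gamma = (\rho(x,x')/\rho(x,y))\, w$.
\<close>

lemma nn_integral_lebesgue_on_eq_integral:
  fixes f :: "real \<Rightarrow> real"
  assumes S: "S \<in> sets lebesgue" and f: "f absolutely_integrable_on S"
    and nonneg: "\<And>x. x \<in> S \<Longrightarrow> 0 \<le> f x"
  shows "(\<integral>\<^sup>+x. ennreal (f x) \<partial>lebesgue_on S) = ennreal (integral S f)"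
proof -
  have "integrable (lebesgue_on S) f"
    using f S by (simp add: integrable_restrict_space set_integrable_def)
  then have "(\<integral>\<^sup>+x. ennreal (f x) \<partial>lebesgue_on S) = ennreal (integral\<^sup>L (lebesgue_on S) f)"
    by (rule nn_integral_eq_integral) (auto intro!: AE_I2 simp: nonneg)
  also have "integral\<^sup>L (lebesgue_on S) f = integral S f"
    using f S set_lebesgue_integral_eq_integral(2)[OF f]
    by (simp add: integral_restrict_space set_lebesgue_integral_def)
  finally show ?thesis .
qed

lemma nn_integral_change_of_variables:
  fixes f g g' :: "real \<Rightarrow> real"
  assumes S: "S \<in> sets lebesgue" and gS: "g ` S \<in> sets lebesgue"
    and deriv: "\<And>x. x \<in> S \<Longrightarrow> (g has_field_derivative g' x) (at x within S)"
    and inj: "inj_on g S"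
    and meas: "f \<in> borel_measurable (lebesgue_on (g ` S))"
    and nonneg: "\<And>y. y \<in> g ` S \<Longrightarrow> 0 \<le> f y"
    and finite: "(\<integral>\<^sup>+y. ennreal (f y) \<partial>lebesgue_on (g ` S)) < \<infinity>"
  shows "(\<integral>\<^sup>+x. ennreal (\<bar>g' x\<bar> * f (g x)) \<partial>lebesgue_on S)
    = (\<integral>\<^sup>+y. ennreal (f y) \<partial>lebesgue_on (g ` S))"
proof -
  have "integrable (lebesgue_on (g ` S)) f"
    using meas finite by (intro integrableI_nonneg) (auto intro!: AE_I2 simp: nonneg)
  then have f: "f absolutely_integrable_on g ` S"
    using gS by (simp add: integrable_restrict_space set_integrable_def)
  then have "(\<lambda>x. \<bar>g' x\<bar> * f (g x)) absolutely_integrable_on S \<and>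
      integral S (\<lambda>x. \<bar>g' x\<bar> * f (g x)) = integral (g ` S) f"
    using has_absolute_integral_change_of_variables_1'[OF S deriv inj] by blast
  then show ?thesis
    using nn_integral_lebesgue_on_eq_integral[OF gS f nonneg]
      nn_integral_lebesgue_on_eq_integral[OF S, of "\<lambda>x. \<bar>g' x\<bar> * f (g x)"] nonneg by simp
qed

lemma borel_measurable_lebesgue_on_ident [measurable]:
  "(\<lambda>x::real. x) \<in> borel_measurable (lebesgue_on S)"
  by (intro measurable_restrict_space1 measurable_completion) simp

lemma borel_measurable_times_indicator_subset:
  fixes f :: "'a \<Rightarrow> ennreal"
  assumes "f \<in> borel_measurable (restrict_space M S)" "T \<subseteq> S" "T \<in> sets M"
  shows "(\<lambda>x. f x * indicator T x) \<in> borel_measurable M"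
  using measurable_restrict_mono[OF assms(1,2)] assms(3) sets.Int_space_eq2[OF assms(3)]
  by (simp add: borel_measurable_restrict_space_iff_ennreal)

lemma nn_integral_cmult_ennreal:
  assumes "0 \<le> c" and [measurable]: "f \<in> borel_measurable M"
  shows "(\<integral>\<^sup>+x. ennreal (c * f x) \<partial>M) = ennreal c * (\<integral>\<^sup>+x. ennreal (f x) \<partial>M)"
  using assms by (simp add: ennreal_mult' nn_integral_cmult)

lemma nn_integral_scaling:
  fixes G :: "real \<Rightarrow> real"
  assumes "\<gamma> > 0" "r > 0"
    and meas [measurable]: "G \<in> borel_measurable (lebesgue_on {0<..})"
    and nonneg: "\<And>w. w > 0 \<Longrightarrow> 0 \<le> G w"
    and finite: "(\<integral>\<^sup>+w. ennreal (G w * w powr (- s / \<gamma>) / w) \<partial>lebesgue_on {0<..}) < \<infinity>"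
  shows "(\<integral>\<^sup>+t. ennreal (G (r / t powr \<gamma>) / t powr (1 - s)) \<partial>lebesgue_on {0<..})
    = ennreal (r powr (s / \<gamma>) / \<gamma>) * (\<integral>\<^sup>+w. ennreal (G w * w powr (- s / \<gamma>) / w) \<partial>lebesgue_on {0<..})"
proof -
  define g where "g = (\<lambda>t::real. r / t powr \<gamma>)"
  define k where "k = r powr (s / \<gamma>) / \<gamma>"
  define f where "f = (\<lambda>w. k * (G w * w powr (- s / \<gamma>) / w))"
  have k: "k > 0" using assms by (simp add: k_def)
  have image: "g ` {0<..} = {0<..}"
  proof safe
    fix w :: real assume "w > 0"
    then have "w = g ((r / w) powr (1 / \<gamma>))" "(r / w) powr (1 / \<gamma>) > 0"
      using assms by (simp_all add: g_def powr_powr)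
    then show "w \<in> g ` {0<..}" by blast
  qed (use assms in \<open>auto simp: g_def\<close>)
  have inj: "inj_on g {0<..}"
  proof (rule inj_onI)
    fix t u :: real assume "t \<in> {0<..}" "u \<in> {0<..}" "g t = g u"
    then have "t powr \<gamma> = u powr \<gamma>" "t > 0" "u > 0" using assms by (auto simp: g_def field_simps)
    then have "(t powr \<gamma>) powr (1 / \<gamma>) = (u powr \<gamma>) powr (1 / \<gamma>)" by simp
    then show "t = u" using assms \<open>t > 0\<close> \<open>u > 0\<close> by (simp add: powr_powr)
  qed
  have deriv: "(g has_field_derivative - (\<gamma> * r / t powr (\<gamma> + 1))) (at t within {0<..})"
    if "t \<in> {0<..}" for t
  proof -
    have "((\<lambda>t. r * t powr (- \<gamma>)) has_field_derivative r * (- \<gamma> * t powr (- \<gamma> - 1))) (at t within {0<..})"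
      using that by (auto intro!: derivative_eq_intros)
    moreover have "r * (- \<gamma> * t powr (- \<gamma> - 1)) = - (\<gamma> * r / t powr (\<gamma> + 1))"
      using powr_minus_divide[of t "\<gamma> + 1"] by simp
    moreover have "(\<lambda>t. r * t powr (- \<gamma>)) = g"
      by (simp add: g_def powr_minus field_simps fun_eq_iff)
    ultimately show ?thesis by simp
  qed
  have int_f: "(\<integral>\<^sup>+w. ennreal (f w) \<partial>lebesgue_on {0<..})
      = ennreal k * (\<integral>\<^sup>+w. ennreal (G w * w powr (- s / \<gamma>) / w) \<partial>lebesgue_on {0<..})"
    unfolding f_def using k by (intro nn_integral_cmult_ennreal) simp_all
  have "(\<integral>\<^sup>+t. ennreal (G (r / t powr \<gamma>) / t powr (1 - s)) \<partial>lebesgue_on {0<..})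
      = (\<integral>\<^sup>+t. ennreal (\<bar>- (\<gamma> * r / t powr (\<gamma> + 1))\<bar> * f (g t)) \<partial>lebesgue_on {0<..})"
  proof (rule nn_integral_cong)
    fix t :: real assume "t \<in> space (lebesgue_on {0<..})"
    then have t: "t > 0" by simp
    have "g t powr (- s / \<gamma>) = r powr (- s / \<gamma>) * t powr s"
      using assms t by (simp add: g_def powr_divide powr_powr powr_minus field_simps)
    then have "r powr (s / \<gamma>) * g t powr (- s / \<gamma>) = t powr s"
      using assms by (simp add: powr_minus field_simps)
    then have "\<bar>- (\<gamma> * r / t powr (\<gamma> + 1))\<bar> * f (g t) = G (g t) * (t powr s / t)"
      using assms t by (simp add: f_def k_def powr_add) (simp add: g_def field_simps)
    also have "t powr s / t = 1 / t powr (1 - s)"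
      using t by (simp add: powr_diff)
    finally show "ennreal (G (r / t powr \<gamma>) / t powr (1 - s))
        = ennreal (\<bar>- (\<gamma> * r / t powr (\<gamma> + 1))\<bar> * f (g t))"
      by (simp add: g_def)
  qed
  also have "\<dots> = (\<integral>\<^sup>+w. ennreal (f w) \<partial>lebesgue_on {0<..})"
  proof (rule nn_integral_change_of_variables[where S = "{0<..}" and g = g, unfolded image])
    show "f \<in> borel_measurable (lebesgue_on {0<..})" unfolding f_def by measurable
    show "(\<integral>\<^sup>+w. ennreal (f w) \<partial>lebesgue_on {0<..}) < \<infinity>"
      unfolding int_f using finite by (simp add: ennreal_mult_less_top)
  qed (use deriv inj k nonneg in \<open>auto simp: f_def\<close>)
  finally show ?thesis by (simp add: int_f k_def)
qed

lemma homogeneous_type_vol_pos: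
  assumes "homogeneous_type M \<rho> A" "x \<in> space M" "r > 0"
  shows "vol M \<rho> x r > 0"
proof -
  obtain C where C: "\<forall>r>0. 0 < emeasure M (qball (space M) \<rho> x (2 * r)) \<and>
      emeasure M (qball (space M) \<rho> x (2 * r)) \<le> ennreal C * emeasure M (qball (space M) \<rho> x r) \<and>
      ennreal C * emeasure M (qball (space M) \<rho> x r) < \<infinity>"
    using assms unfolding homogeneous_type_def by blast
  from C[rule_format, of "r / 2"] assms(3)
  have "0 < emeasure M (qball (space M) \<rho> x r)" "emeasure M (qball (space M) \<rho> x r) < \<infinity>"
    by (auto intro: le_less_trans)
  then show ?thesis
    by (simp add: vol_def measure_def enn2real_positive_iff)
qed

lemma vol_ratio_le:
  assumes "homogeneous_type M \<rho> A" "has_lower_dimension M \<rho> d" "has_upper_dimension M \<rho> D"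
  shows "\<exists>C>0. \<forall>x\<in>space M. \<forall>r>0. \<forall>w>0.
    vol M \<rho> x r / vol M \<rho> x (r / w) \<le> C * (if w \<le> 1 then w powr d else w powr D)"
proof -
  obtain c where c: "c > 0" "\<And>x r R. x \<in> space M \<Longrightarrow> 0 < r \<Longrightarrow> r \<le> R \<Longrightarrow>
      c * (R / r) powr d \<le> vol M \<rho> x R / vol M \<rho> x r"
    using assms(2) unfolding has_lower_dimension_def by blast
  obtain C where C: "C \<ge> 1" "\<And>x r R. x \<in> space M \<Longrightarrow> 0 < r \<Longrightarrow> r \<le> R \<Longrightarrow>
      vol M \<rho> x R / vol M \<rho> x r \<le> C * (R / r) powr D"
    using assms(3) unfolding has_upper_dimension_def by blast
  have "vol M \<rho> x r / vol M \<rho> x (r / w) \<le> max C (1 / c) * (if w \<le> 1 then w powr d else w powr D)"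
    if x: "x \<in> space M" and r: "r > 0" and w: "w > 0" for x r w
  proof (cases "w \<le> 1")
    case True
    have pos: "vol M \<rho> x r > 0" "vol M \<rho> x (r / w) > 0"
      using homogeneous_type_vol_pos[OF assms(1) x] r w by simp_all
    have "c * (1 / w) powr d \<le> vol M \<rho> x (r / w) / vol M \<rho> x r"
      using c(2)[OF x r, of "r / w"] True r w by (simp add: field_simps)
    then have "vol M \<rho> x r / vol M \<rho> x (r / w) \<le> 1 / c * w powr d"
      using pos c(1) w by (simp add: powr_divide field_simps)
    also have "\<dots> \<le> max C (1 / c) * w powr d"
      by (intro mult_right_mono) auto
    finally show ?thesis using True by simp
  next
    case False
    have "vol M \<rho> x r / vol M \<rho> x (r / w) \<le> C * w powr D"
      using C(2)[OF x, of "r / w" r] False r w by (simp add: field_simps)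
    also have "\<dots> \<le> max C (1 / c) * w powr D"
      by (intro mult_right_mono) auto
    finally show ?thesis using False by simp
  qed
  moreover have "max C (1 / c) > 0" using C(1) by simp
  ultimately show ?thesis by blast
qed

lemma vol_ratio_ge:
  assumes "homogeneous_type M \<rho> A" "has_lower_dimension M \<rho> d" "has_upper_dimension M \<rho> D"
  shows "\<exists>c>0. \<forall>x\<in>space M. \<forall>r>0. \<forall>w>0.
    c * (if w \<le> 1 then w powr D else w powr d) \<le> vol M \<rho> x r / vol M \<rho> x (r / w)"
proof -
  obtain c where c: "c > 0" "\<And>x r R. x \<in> space M \<Longrightarrow> 0 < r \<Longrightarrow> r \<le> R \<Longrightarrow>
      c * (R / r) powr d \<le> vol M \<rho> x R / vol M \<rho> x r"
    using assms(2) unfolding has_lower_dimension_def by blast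
  obtain C where C: "C \<ge> 1" "\<And>x r R. x \<in> space M \<Longrightarrow> 0 < r \<Longrightarrow> r \<le> R \<Longrightarrow>
      vol M \<rho> x R / vol M \<rho> x r \<le> C * (R / r) powr D"
    using assms(3) unfolding has_upper_dimension_def by blast
  have "min c (1 / C) * (if w \<le> 1 then w powr D else w powr d) \<le> vol M \<rho> x r / vol M \<rho> x (r / w)"
    if x: "x \<in> space M" and r: "r > 0" and w: "w > 0" for x r w
  proof (cases "w \<le> 1")
    case True
    have pos: "vol M \<rho> x r > 0" "vol M \<rho> x (r / w) > 0"
      using homogeneous_type_vol_pos[OF assms(1) x] r w by simp_all
    have "min c (1 / C) * w powr D \<le> 1 / C * w powr D"
      by (intro mult_right_mono) auto
    also have "vol M \<rho> x (r / w) / vol M \<rho> x r \<le> C * (1 / w) powr D"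
      using C(2)[OF x r, of "r / w"] True r w by (simp add: field_simps)
    then have "1 / C * w powr D \<le> vol M \<rho> x r / vol M \<rho> x (r / w)"
      using pos C(1) w by (simp add: powr_divide field_simps)
    finally show ?thesis using True by simp
  next
    case False
    have "min c (1 / C) * w powr d \<le> c * w powr d"
      by (intro mult_right_mono) auto
    also have "\<dots> \<le> vol M \<rho> x r / vol M \<rho> x (r / w)"
      using c(2)[OF x, of "r / w" r] False r w by (simp add: field_simps)
    finally show ?thesis using False by simp
  qed
  moreover have "min c (1 / C) > 0" using c(1) C(1) by simp
  ultimately show ?thesis by blast
qed

lemma nn_integral_scaled_bound_le:
  fixes \<Phi> :: "real \<Rightarrow> real"
  assumes "\<gamma> > 0" and hom: "homogeneous_type M \<rho> A"
    and dims: "has_lower_dimension M \<rho> d" "has_upper_dimension M \<rho> D"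
    and meas [measurable]: "\<Phi> \<in> borel_measurable (lebesgue_on {0<..})"
    and nonneg: "\<And>w. w > 0 \<Longrightarrow> 0 \<le> \<Phi> w"
    and finite: "(\<integral>\<^sup>+w\<in>{0<..1}. ennreal (\<Phi> w * w powr (d - s / \<gamma>) / w) \<partial>lebesgue)
      + (\<integral>\<^sup>+w\<in>{1..}. ennreal (\<Phi> w * w powr (D - s / \<gamma>) / w) \<partial>lebesgue) < \<infinity>"
  obtains B where "B > 0" and "\<forall>x\<in>space M. \<forall>r>0. \<forall>a\<ge>0. \<forall>f.
    (\<forall>t>0. f t \<le> a * (1 / vol M \<rho> x (t powr \<gamma>) * \<Phi> (r / t powr \<gamma>))) \<longrightarrow>
    (\<integral>\<^sup>+t. ennreal (f t / t powr (1 - s)) \<partial>lebesgue_on {0<..})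
      \<le> ennreal (a * B * (r powr (s / \<gamma>) / vol M \<rho> x r))"
proof -
  define m where "m = (\<lambda>w::real. if w \<le> 1 then w powr d else w powr D)"
  have m_nonneg: "m w \<ge> 0" for w by (simp add: m_def)
  have m_meas [measurable]: "m \<in> borel_measurable (lebesgue_on {0<..})"
    unfolding m_def by measurable
  obtain C where C: "C > 0" "\<And>x r w. x \<in> space M \<Longrightarrow> r > 0 \<Longrightarrow> w > 0 \<Longrightarrow>
      vol M \<rho> x r / vol M \<rho> x (r / w) \<le> C * m w"
    using vol_ratio_le[OF hom dims] unfolding m_def by blast
  define J where "J = (\<integral>\<^sup>+w. ennreal (m w * \<Phi> w * w powr (- s / \<gamma>) / w) \<partial>lebesgue_on {0<..})"
  have "J = (\<integral>\<^sup>+w. ennreal (m w * \<Phi> w * w powr (- s / \<gamma>) / w) * indicator {0<..} w \<partial>lebesgue)"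
    by (simp add: J_def nn_integral_restrict_space)
  also have "\<dots> \<le> (\<integral>\<^sup>+w. ennreal (\<Phi> w * w powr (d - s / \<gamma>) / w) * indicator {0<..1} w
      + ennreal (\<Phi> w * w powr (D - s / \<gamma>) / w) * indicator {1..} w \<partial>lebesgue)"
  proof (rule nn_integral_mono)
    fix w :: real
    have eq: "m w * \<Phi> w * w powr (- s / \<gamma>) = \<Phi> w * w powr ((if w \<le> 1 then d else D) - s / \<gamma>)"
      using powr_add[of w "if w \<le> 1 then d else D" "- s / \<gamma>"] by (simp add: m_def)
    show "ennreal (m w * \<Phi> w * w powr (- s / \<gamma>) / w) * indicator {0<..} w
        \<le> ennreal (\<Phi> w * w powr (d - s / \<gamma>) / w) * indicator {0<..1} w
          + ennreal (\<Phi> w * w powr (D - s / \<gamma>) / w) * indicator {1..} w"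
      unfolding eq by (cases "w \<le> 1"; cases "w > 0") (simp_all add: indicator_def)
  qed
  also have "\<dots> = (\<integral>\<^sup>+w\<in>{0<..1}. ennreal (\<Phi> w * w powr (d - s / \<gamma>) / w) \<partial>lebesgue)
      + (\<integral>\<^sup>+w\<in>{1..}. ennreal (\<Phi> w * w powr (D - s / \<gamma>) / w) \<partial>lebesgue)"
    by (rule nn_integral_add; rule borel_measurable_times_indicator_subset[where S = "{0<..}"]) auto
  finally have J: "J < \<infinity>" using finite by (auto intro: le_less_trans)
  define j where "j = enn2real J + 1"
  have j: "j > 0" "J \<le> ennreal j"
    using J by (auto simp: j_def add_nonneg_pos ennreal_plus)
  define B where "B = C * j / \<gamma>"
  have bound: "(\<integral>\<^sup>+t. ennreal (f t / t powr (1 - s)) \<partial>lebesgue_on {0<..})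
      \<le> ennreal (a * B * (r powr (s / \<gamma>) / vol M \<rho> x r))"
    if x: "x \<in> space M" and r: "r > 0" and a: "a \<ge> 0"
      and f: "\<And>t. t > 0 \<Longrightarrow> f t \<le> a * (1 / vol M \<rho> x (t powr \<gamma>) * \<Phi> (r / t powr \<gamma>))" for x r a f
  proof -
    define k where "k = a * C / vol M \<rho> x r"
    have vol_r: "vol M \<rho> x r > 0" using homogeneous_type_vol_pos[OF hom x r] .
    have k: "k \<ge> 0" using a C(1) vol_r by (simp add: k_def)
    have scaled: "(\<integral>\<^sup>+w. ennreal (k * (m w * \<Phi> w) * w powr (- s / \<gamma>) / w) \<partial>lebesgue_on {0<..}) = ennreal k * J"
      using nn_integral_cmult_ennreal[OF k, of "\<lambda>w. m w * \<Phi> w * w powr (- s / \<gamma>) / w" "lebesgue_on {0<..}"]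
      by (simp add: J_def mult.assoc)
    have scaled_finite: "ennreal k * J < \<infinity>" using J by (simp add: ennreal_mult_less_top)
    have "(\<integral>\<^sup>+t. ennreal (f t / t powr (1 - s)) \<partial>lebesgue_on {0<..})
      \<le> (\<integral>\<^sup>+t. ennreal (k * (m (r / t powr \<gamma>) * \<Phi> (r / t powr \<gamma>)) / t powr (1 - s)) \<partial>lebesgue_on {0<..})"
    proof (intro nn_integral_mono ennreal_leI divide_right_mono)
      fix t :: real assume "t \<in> space (lebesgue_on {0<..})"
      then have t: "t > 0" by simp
      define w where "w = r / t powr \<gamma>"
      have w: "w > 0" "r / w = t powr \<gamma>" using t r by (simp_all add: w_def)
      have vol_t: "vol M \<rho> x (t powr \<gamma>) > 0" using homogeneous_type_vol_pos[OF hom x] t by simp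
      have "1 / vol M \<rho> x (t powr \<gamma>) \<le> C * m w / vol M \<rho> x r"
        using C(2)[OF x r w(1)] vol_r vol_t unfolding w(2) by (simp add: field_simps)
      then have "a * (1 / vol M \<rho> x (t powr \<gamma>) * \<Phi> w) \<le> a * (C * m w / vol M \<rho> x r * \<Phi> w)"
        using a nonneg[OF w(1)] by (intro mult_left_mono mult_right_mono)
      moreover have "f t \<le> a * (1 / vol M \<rho> x (t powr \<gamma>) * \<Phi> w)"
        using f t by (simp add: w_def)
      ultimately show "f t \<le> k * (m (r / t powr \<gamma>) * \<Phi> (r / t powr \<gamma>))"
        by (simp add: k_def w_def[symmetric] mult_ac)
    qed simp
    also have "\<dots> = ennreal (r powr (s / \<gamma>) / \<gamma>) * (ennreal k * J)"
      unfolding scaled[symmetric]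
    proof (rule nn_integral_scaling)
      show "(\<integral>\<^sup>+w. ennreal (k * (m w * \<Phi> w) * w powr (- s / \<gamma>) / w) \<partial>lebesgue_on {0<..}) < \<infinity>"
        unfolding scaled by (fact scaled_finite)
    qed (use assms(1) r k nonneg m_nonneg in auto)
    also have "\<dots> \<le> ennreal (r powr (s / \<gamma>) / \<gamma>) * (ennreal k * ennreal j)"
      by (intro mult_left_mono j) auto
    also have "\<dots> = ennreal (a * B * (r powr (s / \<gamma>) / vol M \<rho> x r))"
    proof -
      have eq: "a * B * (r powr (s / \<gamma>) / vol M \<rho> x r) = r powr (s / \<gamma>) / \<gamma> * (k * j)"
        by (simp add: k_def B_def)
      show ?thesis
        unfolding eq using assms(1) k j by (subst ennreal_mult) (simp_all add: ennreal_mult)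
    qed
    finally show ?thesis .
  qed
  have "B > 0" using C(1) assms(1) j by (simp add: B_def)
  then show ?thesis by (rule that) (intro ballI allI impI; rule bound; simp)
qed

lemma nn_integral_scaled_bound_ge:
  fixes \<Phi> :: "real \<Rightarrow> real"
  assumes "\<gamma> > 0" and hom: "homogeneous_type M \<rho> A"
    and dims: "has_lower_dimension M \<rho> d" "has_upper_dimension M \<rho> D"
    and meas [measurable]: "\<Phi> \<in> borel_measurable (lebesgue_on {0<..})"
    and nonneg: "\<And>w. w > 0 \<Longrightarrow> 0 \<le> \<Phi> w"
    and pos: "emeasure lebesgue {w. w \<ge> 0 \<and> \<Phi> w \<noteq> 0} > 0"
  obtains b where "b > 0" and "\<forall>x\<in>space M. \<forall>r>0. \<forall>a\<ge>0. \<forall>f.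
    (\<forall>t>0. a * (1 / vol M \<rho> x (t powr \<gamma>) * \<Phi> (r / t powr \<gamma>)) \<le> f t) \<longrightarrow>
    ennreal (a * b * (r powr (s / \<gamma>) / vol M \<rho> x r))
      \<le> (\<integral>\<^sup>+t. ennreal (f t / t powr (1 - s)) \<partial>lebesgue_on {0<..})"
proof -
  define m where "m = (\<lambda>w::real. if w \<le> 1 then w powr D else w powr d)"
  have m_nonneg: "m w \<ge> 0" for w by (simp add: m_def)
  have m_pos: "m w > 0" if "w > 0" for w using that by (simp add: m_def)
  have [measurable]: "m \<in> borel_measurable (lebesgue_on {0<..})"
    unfolding m_def by measurable
  obtain c where c: "c > 0" "\<And>x r w. x \<in> space M \<Longrightarrow> r > 0 \<Longrightarrow> w > 0 \<Longrightarrow>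
      c * m w \<le> vol M \<rho> x r / vol M \<rho> x (r / w)"
    using vol_ratio_ge[OF hom dims] unfolding m_def by blast
  text \<open>The truncation makes the integral over \<open>w\<close> finite; only its positivity matters.\<close>
  define G where "G = (\<lambda>w. min (m w * \<Phi> w) (exp (- w) * w * w powr (s / \<gamma>)))"
  define J where "J = (\<integral>\<^sup>+w. ennreal (G w * w powr (- s / \<gamma>) / w) \<partial>lebesgue_on {0<..})"
  have [measurable]: "G \<in> borel_measurable (lebesgue_on {0<..})"
    unfolding G_def by measurable
  have G_nonneg: "G w \<ge> 0" if "w > 0" for w
    using that nonneg m_nonneg by (simp add: G_def)
  have G_le: "G w * w powr (- s / \<gamma>) / w \<le> exp (- w)" if "w > 0" for w
  proof -
    have "G w * w powr (- s / \<gamma>) \<le> (exp (- w) * w * w powr (s / \<gamma>)) * w powr (- s / \<gamma>)"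
      by (intro mult_right_mono) (auto simp: G_def)
    also have "\<dots> = exp (- w) * w"
      using that by (simp add: powr_minus)
    finally show ?thesis using that by (simp add: field_simps)
  qed
  have "J \<le> (\<integral>\<^sup>+w. ennreal (exp (- w)) \<partial>lebesgue_on {0<..})"
    unfolding J_def by (intro nn_integral_mono ennreal_leI G_le) simp
  also have "\<dots> \<le> (\<integral>\<^sup>+w. ennreal (exp (- w)) * indicator {0..} w \<partial>lebesgue)"
    by (auto simp: nn_integral_restrict_space indicator_def intro!: nn_integral_mono)
  also have "\<dots> < \<infinity>"
    using nn_integral_has_integral_lebesgue'[OF _ has_integral_exp_minus_to_infinity[of 1 0]]
    by (simp add: nn_integral_completion)
  finally have J: "J < \<infinity>" .
  have "J \<noteq> 0"
  proof
    assume "J = 0"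
    then have "emeasure (lebesgue_on {0<..})
        {w \<in> space (lebesgue_on {0<..}). ennreal (G w * w powr (- s / \<gamma>) / w) \<noteq> 0} = 0"
      unfolding J_def by (subst (asm) nn_integral_0_iff) measurable
    then have "{w \<in> space (lebesgue_on {0<..}). ennreal (G w * w powr (- s / \<gamma>) / w) \<noteq> 0}
        \<in> null_sets (lebesgue_on {0<..})"
      by (rule null_setsI) measurable
    also have "{w \<in> space (lebesgue_on {0<..}). ennreal (G w * w powr (- s / \<gamma>) / w) \<noteq> 0} = {w. w > 0 \<and> \<Phi> w \<noteq> 0}"
    proof -
      have "ennreal (G w * w powr (- s / \<gamma>) / w) \<noteq> 0 \<longleftrightarrow> \<Phi> w \<noteq> 0" if "w > 0" for w
      proof -
        have "exp (- w) * w * w powr (s / \<gamma>) > 0" using that by simp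
        then have "G w > 0 \<longleftrightarrow> \<Phi> w \<noteq> 0"
          using nonneg[OF that] m_pos[OF that] by (auto simp: G_def zero_less_mult_iff)
        then show ?thesis
          using that by (simp add: ennreal_eq_0_iff not_le zero_less_mult_iff zero_less_divide_iff)
      qed
      then show ?thesis by auto
    qed
    finally have "{w. w > 0 \<and> \<Phi> w \<noteq> 0} \<in> null_sets lebesgue"
      by (simp add: null_sets_restrict_space)
    then have "{w. w > 0 \<and> \<Phi> w \<noteq> 0} \<union> {0} \<in> null_sets lebesgue"
      by (intro null_sets.Un) (auto simp: null_sets_def)
    moreover have "{w. w \<ge> 0 \<and> \<Phi> w \<noteq> 0} \<subseteq> {w. w > 0 \<and> \<Phi> w \<noteq> 0} \<union> {0}" by auto
    ultimately have "emeasure lebesgue {w. w \<ge> 0 \<and> \<Phi> w \<noteq> 0} = 0"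
      by (metis emeasure_eq_0 null_setsD1 null_setsD2)
    with pos show False by simp
  qed
  then have J_pos: "enn2real J > 0" using J by (simp add: enn2real_positive_iff zero_less_iff_neq_zero)
  define b where "b = c * enn2real J / \<gamma>"
  have bound: "ennreal (a * b * (r powr (s / \<gamma>) / vol M \<rho> x r))
      \<le> (\<integral>\<^sup>+t. ennreal (f t / t powr (1 - s)) \<partial>lebesgue_on {0<..})"
    if x: "x \<in> space M" and r: "r > 0" and a: "a \<ge> 0"
      and f: "\<And>t. t > 0 \<Longrightarrow> a * (1 / vol M \<rho> x (t powr \<gamma>) * \<Phi> (r / t powr \<gamma>)) \<le> f t" for x r a f
  proof -
    define k where "k = a * c / vol M \<rho> x r"
    have vol_r: "vol M \<rho> x r > 0" using homogeneous_type_vol_pos[OF hom x r] .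
    have k: "k \<ge> 0" using a c(1) vol_r by (simp add: k_def)
    have scaled: "(\<integral>\<^sup>+w. ennreal (k * G w * w powr (- s / \<gamma>) / w) \<partial>lebesgue_on {0<..}) = ennreal k * J"
      using nn_integral_cmult_ennreal[OF k, of "\<lambda>w. G w * w powr (- s / \<gamma>) / w" "lebesgue_on {0<..}"]
      by (simp add: J_def mult.assoc)
    have scaled_finite: "ennreal k * J < \<infinity>" using J by (simp add: ennreal_mult_less_top)
    have "ennreal (a * b * (r powr (s / \<gamma>) / vol M \<rho> x r))
        = ennreal (r powr (s / \<gamma>) / \<gamma>) * (ennreal k * ennreal (enn2real J))"
    proof -
      have eq: "a * b * (r powr (s / \<gamma>) / vol M \<rho> x r) = r powr (s / \<gamma>) / \<gamma> * (k * enn2real J)"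
        by (simp add: k_def b_def)
      show ?thesis
        unfolding eq using assms(1) k by (subst ennreal_mult) (simp_all add: ennreal_mult)
    qed
    also have "\<dots> = ennreal (r powr (s / \<gamma>) / \<gamma>) * (ennreal k * J)"
      using J by simp
    also have "\<dots> = (\<integral>\<^sup>+t. ennreal (k * G (r / t powr \<gamma>) / t powr (1 - s)) \<partial>lebesgue_on {0<..})"
      unfolding scaled[symmetric]
    proof (rule nn_integral_scaling[symmetric])
      show "(\<integral>\<^sup>+w. ennreal (k * G w * w powr (- s / \<gamma>) / w) \<partial>lebesgue_on {0<..}) < \<infinity>"
        unfolding scaled by (fact scaled_finite)
    qed (use assms(1) r k G_nonneg in auto)
    also have "\<dots> \<le> (\<integral>\<^sup>+t. ennreal (f t / t powr (1 - s)) \<partial>lebesgue_on {0<..})"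
    proof (intro nn_integral_mono ennreal_leI divide_right_mono)
      fix t :: real assume "t \<in> space (lebesgue_on {0<..})"
      then have t: "t > 0" by simp
      define w where "w = r / t powr \<gamma>"
      have w: "w > 0" "r / w = t powr \<gamma>" using t r by (simp_all add: w_def)
      have vol_t: "vol M \<rho> x (t powr \<gamma>) > 0" using homogeneous_type_vol_pos[OF hom x] t by simp
      have "k * G w \<le> k * (m w * \<Phi> w)"
        using k by (intro mult_left_mono) (simp_all add: G_def)
      also have "\<dots> = a * (c * m w / vol M \<rho> x r * \<Phi> w)"
        by (simp add: k_def)
      also have "c * m w / vol M \<rho> x r \<le> 1 / vol M \<rho> x (t powr \<gamma>)"
        using c(2)[OF x r w(1)] vol_r vol_t unfolding w(2) by (simp add: field_simps)
      then have "a * (c * m w / vol M \<rho> x r * \<Phi> w) \<le> a * (1 / vol M \<rho> x (t powr \<gamma>) * \<Phi> w)"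
        using a nonneg[OF w(1)] by (intro mult_left_mono mult_right_mono)
      also have "\<dots> \<le> f t"
        using f t by (simp add: w_def)
      finally show "k * G (r / t powr \<gamma>) \<le> f t"
        by (simp add: w_def)
    qed simp
    finally show ?thesis .
  qed
  have "b > 0" using c(1) assms(1) J_pos by (simp add: b_def)
  then show ?thesis by (rule that) (intro ballI allI impI; rule bound; simp)
qed

lemma frac_kernel_lebesgue_on:
  "frac_kernel p s x y = ennreal (1 / Gamma s) *
    (\<integral>\<^sup>+t. ennreal (p t x y / t powr (1 - s)) \<partial>lebesgue_on {0<..})"
  by (simp add: frac_kernel_def nn_integral_restrict_space)

lemma frac_kernel_diff_le:
  assumes "s > 0"
    and [measurable]: "(\<lambda>t. p t x y) \<in> borel_measurable (lebesgue_on {0<..})"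
      "(\<lambda>t. p t x' y') \<in> borel_measurable (lebesgue_on {0<..})"
    and fin: "frac_kernel p s x y < \<infinity>" "frac_kernel p s x' y' < \<infinity>"
    and "b \<ge> 0"
    and le: "(\<integral>\<^sup>+t. ennreal (\<bar>p t x y - p t x' y'\<bar> / t powr (1 - s)) \<partial>lebesgue_on {0<..}) \<le> ennreal b"
  shows "\<bar>enn2real (frac_kernel p s x y) - enn2real (frac_kernel p s x' y')\<bar> \<le> b / Gamma s"
proof -
  have G: "Gamma s > 0" using assms(1) by simp
  have *: "enn2real (frac_kernel p s u v) \<le> enn2real (frac_kernel p s u' v') + b / Gamma s"
    if [measurable]: "(\<lambda>t. p t u v) \<in> borel_measurable (lebesgue_on {0<..})"
      "(\<lambda>t. p t u' v') \<in> borel_measurable (lebesgue_on {0<..})"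
      and fin': "frac_kernel p s u' v' < \<infinity>"
      and le': "(\<integral>\<^sup>+t. ennreal (\<bar>p t u v - p t u' v'\<bar> / t powr (1 - s)) \<partial>lebesgue_on {0<..}) \<le> ennreal b"
    for u v u' v'
  proof -
    have "(\<integral>\<^sup>+t. ennreal (p t u v / t powr (1 - s)) \<partial>lebesgue_on {0<..})
      \<le> (\<integral>\<^sup>+t. ennreal (p t u' v' / t powr (1 - s))
          + ennreal (\<bar>p t u v - p t u' v'\<bar> / t powr (1 - s)) \<partial>lebesgue_on {0<..})"
    proof (rule nn_integral_mono)
      fix t :: real
      have "p t u v / t powr (1 - s)
          \<le> max 0 (p t u' v' / t powr (1 - s)) + \<bar>p t u v - p t u' v'\<bar> / t powr (1 - s)"
        using divide_right_mono[of "p t u v" "p t u' v' + \<bar>p t u v - p t u' v'\<bar>" "t powr (1 - s)"]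
        unfolding add_divide_distrib by fastforce
      then have "ennreal (p t u v / t powr (1 - s))
          \<le> ennreal (max 0 (p t u' v' / t powr (1 - s)) + \<bar>p t u v - p t u' v'\<bar> / t powr (1 - s))"
        by (rule ennreal_leI)
      also have "\<dots> = ennreal (max 0 (p t u' v' / t powr (1 - s))) + ennreal (\<bar>p t u v - p t u' v'\<bar> / t powr (1 - s))"
        by (rule ennreal_plus) simp_all
      finally show "ennreal (p t u v / t powr (1 - s))
          \<le> ennreal (p t u' v' / t powr (1 - s)) + ennreal (\<bar>p t u v - p t u' v'\<bar> / t powr (1 - s))"
        by (simp add: ennreal_max_0)
    qed
    also have "\<dots> = (\<integral>\<^sup>+t. ennreal (p t u' v' / t powr (1 - s)) \<partial>lebesgue_on {0<..})
        + (\<integral>\<^sup>+t. ennreal (\<bar>p t u v - p t u' v'\<bar> / t powr (1 - s)) \<partial>lebesgue_on {0<..})"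
      by (rule nn_integral_add) measurable
    also have "\<dots> \<le> (\<integral>\<^sup>+t. ennreal (p t u' v' / t powr (1 - s)) \<partial>lebesgue_on {0<..}) + ennreal b"
      using le' by (intro add_left_mono)
    finally have "frac_kernel p s u v \<le> ennreal (1 / Gamma s) *
        ((\<integral>\<^sup>+t. ennreal (p t u' v' / t powr (1 - s)) \<partial>lebesgue_on {0<..}) + ennreal b)"
      unfolding frac_kernel_lebesgue_on by (rule mult_left_mono) simp
    also have "\<dots> = frac_kernel p s u' v' + ennreal (b / Gamma s)"
      unfolding frac_kernel_lebesgue_on using G \<open>b \<ge> 0\<close>
      by (simp add: distrib_left ennreal_mult[symmetric])
    finally have "enn2real (frac_kernel p s u v) \<le> enn2real (frac_kernel p s u' v' + ennreal (b / Gamma s))"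
      using fin' by (intro enn2real_mono) auto
    also have "\<dots> = enn2real (frac_kernel p s u' v') + b / Gamma s"
      using fin' G \<open>b \<ge> 0\<close> by (subst enn2real_plus) auto
    finally show ?thesis .
  qed
  show ?thesis
    using *[of x y x' y'] *[of x' y' x y] fin le by (simp add: abs_le_iff abs_minus_commute)
qed

theorem proposition11p2:
  fixes M :: "'a measure" and \<rho> :: "'a \<Rightarrow> 'a \<Rightarrow> real" and A\<^sub>0 d D \<gamma> s \<epsilon> :: real
    and p :: "real \<Rightarrow> 'a \<Rightarrow> 'a \<Rightarrow> real" and L :: "(('a \<Rightarrow> real) \<times> ('a \<Rightarrow> real)) set"
    and K :: "'a \<Rightarrow> 'a \<Rightarrow> ennreal"
    and \<Phi>\<^sub>1 \<Phi>\<^sub>2 \<Phi>\<^sub>3 :: "real \<Rightarrow> real"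
  assumes "\<gamma> > 0" and "s > 0" and "\<epsilon> > 0"
    and "homogeneous_type M \<rho> A\<^sub>0"
    and "has_lower_dimension M \<rho> d" and "has_upper_dimension M \<rho> D"
    and "heat_kernel M p" and "L = heat_generator M p"
    and "\<forall>x\<in>space M. \<forall>y\<in>space M. (\<lambda>t. p t x y) \<in> borel_measurable (lebesgue_on {0<..})"
    and "K = frac_kernel p s"
    and "\<forall>\<Phi>\<in>{\<Phi>\<^sub>1, \<Phi>\<^sub>2, \<Phi>\<^sub>3}. \<Phi> \<in> borel_measurable (lebesgue_on {0..}) \<and> (\<forall>w\<ge>0. \<Phi> w \<ge> 0)"
  shows
    "((\<exists>C>0. \<forall>x\<in>space M. \<forall>y\<in>space M. \<forall>t>0.
          p t x y \<le> C * (1 / vol M \<rho> x (t powr \<gamma>) * \<Phi>\<^sub>1 (\<rho> x y / t powr \<gamma>))) \<and>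
      (\<integral>\<^sup>+w\<in>{0<..1}. ennreal (\<Phi>\<^sub>1 w * w powr (d - s / \<gamma>) / w) \<partial>lebesgue)
        + (\<integral>\<^sup>+w\<in>{1..}. ennreal (\<Phi>\<^sub>1 w * w powr (D - s / \<gamma>) / w) \<partial>lebesgue) < \<infinity>
      \<longrightarrow>
      (\<exists>C>0. \<forall>x\<in>space M. \<forall>y\<in>space M. x \<noteq> y \<longrightarrow>
          K x y \<le> ennreal (C * (\<rho> x y powr (s / \<gamma>) / vol M \<rho> x (\<rho> x y)))))
   \<and> ((\<exists>c>0. \<forall>x\<in>space M. \<forall>y\<in>space M. \<forall>t>0.
          p t x y \<ge> c * (1 / vol M \<rho> x (t powr \<gamma>) * \<Phi>\<^sub>2 (\<rho> x y / t powr \<gamma>))) \<and>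
      emeasure lebesgue {w. w \<ge> 0 \<and> \<Phi>\<^sub>2 w \<noteq> 0} > 0
      \<longrightarrow>
      (\<exists>c>0. \<forall>x\<in>space M. \<forall>y\<in>space M. x \<noteq> y \<longrightarrow>
          K x y \<ge> ennreal (c * (\<rho> x y powr (s / \<gamma>) / vol M \<rho> x (\<rho> x y)))))
   \<and> ((\<exists>C>0. \<forall>x\<in>space M. \<forall>x'\<in>space M. \<forall>y\<in>space M. \<forall>t>0. \<rho> x x' < inverse (2 * A\<^sub>0) * \<rho> x y \<longrightarrow>
          \<bar>p t x y - p t x' y\<bar> + \<bar>p t y x - p t y x'\<bar>
            \<le> C * (1 / vol M \<rho> x (t powr \<gamma>) * (\<rho> x x' / t powr \<gamma>) powr \<epsilon>
                    * \<Phi>\<^sub>3 (\<rho> x y / t powr \<gamma>))) \<and>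
      (\<integral>\<^sup>+w\<in>{0<..1}. ennreal (\<Phi>\<^sub>3 w * w powr (d + \<epsilon> - s / \<gamma>) / w) \<partial>lebesgue)
        + (\<integral>\<^sup>+w\<in>{1..}. ennreal (\<Phi>\<^sub>3 w * w powr (D + \<epsilon> - s / \<gamma>) / w) \<partial>lebesgue) < \<infinity>
      \<longrightarrow>
      (\<exists>C>0. \<forall>x\<in>space M. \<forall>x'\<in>space M. \<forall>y\<in>space M. \<rho> x x' < inverse (2 * A\<^sub>0) * \<rho> x y \<longrightarrow>
          K x y < \<infinity> \<and> K x' y < \<infinity> \<and> K y x < \<infinity> \<and> K y x' < \<infinity> \<longrightarrow>
          \<bar>enn2real (K x y) - enn2real (K x' y)\<bar> + \<bar>enn2real (K y x) - enn2real (K y x')\<bar>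
            \<le> C * (\<rho> x y powr (s / \<gamma>) / vol M \<rho> x (\<rho> x y) * (\<rho> x x' / \<rho> x y) powr \<epsilon>)))"
proof (intro conjI impI)
  note hom = assms(4) and dims = assms(5,6)
  have G: "Gamma s > 0" using assms(2) by simp
  have restr: "f \<in> borel_measurable (lebesgue_on {0<..})"
    if "f \<in> borel_measurable (lebesgue_on {0..})" for f :: "real \<Rightarrow> real"
    using that by (rule measurable_restrict_mono) auto
  have meas: "\<Phi>\<^sub>1 \<in> borel_measurable (lebesgue_on {0<..})" "\<Phi>\<^sub>2 \<in> borel_measurable (lebesgue_on {0<..})"
    "\<Phi>\<^sub>3 \<in> borel_measurable (lebesgue_on {0<..})"
    using assms(11) by (blast intro: restr)+
  have nonneg: "\<And>w. w > 0 \<Longrightarrow> \<Phi>\<^sub>1 w \<ge> 0" "\<And>w. w > 0 \<Longrightarrow> \<Phi>\<^sub>2 w \<ge> 0" "\<And>w. w > 0 \<Longrightarrow> \<Phi>\<^sub>3 w \<ge> 0"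
    using assms(11) by simp_all
  have qm: "quasi_metric_on (space M) \<rho> A\<^sub>0"
    using hom unfolding homogeneous_type_def by (rule conjunct1)
  then have \<rho>_nonneg: "\<rho> x y \<ge> 0" if "x \<in> space M" "y \<in> space M" for x y
    using that unfolding quasi_metric_on_def by blast
  have \<rho>_pos: "\<rho> x y > 0" if "x \<in> space M" "y \<in> space M" "x \<noteq> y" for x y
  proof -
    have "\<rho> x y \<noteq> 0" using qm that unfolding quasi_metric_on_def by blast
    then show ?thesis using \<rho>_nonneg[OF that(1,2)] by simp
  qed
  have A: "A\<^sub>0 > 0" using qm unfolding quasi_metric_on_def by linarith
  {
    assume "(\<exists>C>0. \<forall>x\<in>space M. \<forall>y\<in>space M. \<forall>t>0.
          p t x y \<le> C * (1 / vol M \<rho> x (t powr \<gamma>) * \<Phi>\<^sub>1 (\<rho> x y / t powr \<gamma>))) \<and>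
      (\<integral>\<^sup>+w\<in>{0<..1}. ennreal (\<Phi>\<^sub>1 w * w powr (d - s / \<gamma>) / w) \<partial>lebesgue)
        + (\<integral>\<^sup>+w\<in>{1..}. ennreal (\<Phi>\<^sub>1 w * w powr (D - s / \<gamma>) / w) \<partial>lebesgue) < \<infinity>"
    then obtain C where C: "C > 0" "\<And>x y t. x \<in> space M \<Longrightarrow> y \<in> space M \<Longrightarrow> t > 0 \<Longrightarrow>
          p t x y \<le> C * (1 / vol M \<rho> x (t powr \<gamma>) * \<Phi>\<^sub>1 (\<rho> x y / t powr \<gamma>))"
      and fin: "(\<integral>\<^sup>+w\<in>{0<..1}. ennreal (\<Phi>\<^sub>1 w * w powr (d - s / \<gamma>) / w) \<partial>lebesgue)
        + (\<integral>\<^sup>+w\<in>{1..}. ennreal (\<Phi>\<^sub>1 w * w powr (D - s / \<gamma>) / w) \<partial>lebesgue) < \<infinity>"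
      by blast
    obtain B where B: "B > 0" "\<forall>x\<in>space M. \<forall>r>0. \<forall>a\<ge>0. \<forall>f.
        (\<forall>t>0. f t \<le> a * (1 / vol M \<rho> x (t powr \<gamma>) * \<Phi>\<^sub>1 (r / t powr \<gamma>))) \<longrightarrow>
        (\<integral>\<^sup>+t. ennreal (f t / t powr (1 - s)) \<partial>lebesgue_on {0<..})
          \<le> ennreal (a * B * (r powr (s / \<gamma>) / vol M \<rho> x r))"
      by (rule nn_integral_scaled_bound_le[OF assms(1) hom dims meas(1) nonneg(1) fin])
    have "K x y \<le> ennreal (C * B / Gamma s * (\<rho> x y powr (s / \<gamma>) / vol M \<rho> x (\<rho> x y)))"
      if xy: "x \<in> space M" "y \<in> space M" "x \<noteq> y" for x y
    proof -
      have "K x y \<le> ennreal (1 / Gamma s) * ennreal (C * B * (\<rho> x y powr (s / \<gamma>) / vol M \<rho> x (\<rho> x y)))"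
        unfolding assms(10) frac_kernel_lebesgue_on
        using C xy \<rho>_pos by (intro mult_left_mono B(2)[rule_format]) auto
      also have "\<dots> = ennreal (C * B / Gamma s * (\<rho> x y powr (s / \<gamma>) / vol M \<rho> x (\<rho> x y)))"
        using G by (simp add: ennreal_mult'[symmetric] mult_ac)
      finally show ?thesis .
    qed
    moreover have "C * B / Gamma s > 0" using B(1) C(1) G by simp
    ultimately show "\<exists>C>0. \<forall>x\<in>space M. \<forall>y\<in>space M. x \<noteq> y \<longrightarrow>
        K x y \<le> ennreal (C * (\<rho> x y powr (s / \<gamma>) / vol M \<rho> x (\<rho> x y)))" by blast
  next
    assume "(\<exists>c>0. \<forall>x\<in>space M. \<forall>y\<in>space M. \<forall>t>0.
          p t x y \<ge> c * (1 / vol M \<rho> x (t powr \<gamma>) * \<Phi>\<^sub>2 (\<rho> x y / t powr \<gamma>))) \<and>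
      emeasure lebesgue {w. w \<ge> 0 \<and> \<Phi>\<^sub>2 w \<noteq> 0} > 0"
    then obtain c where c: "c > 0" "\<And>x y t. x \<in> space M \<Longrightarrow> y \<in> space M \<Longrightarrow> t > 0 \<Longrightarrow>
          p t x y \<ge> c * (1 / vol M \<rho> x (t powr \<gamma>) * \<Phi>\<^sub>2 (\<rho> x y / t powr \<gamma>))"
      and pos: "emeasure lebesgue {w. w \<ge> 0 \<and> \<Phi>\<^sub>2 w \<noteq> 0} > 0"
      by blast
    obtain b where b: "b > 0" "\<forall>x\<in>space M. \<forall>r>0. \<forall>a\<ge>0. \<forall>f.
        (\<forall>t>0. a * (1 / vol M \<rho> x (t powr \<gamma>) * \<Phi>\<^sub>2 (r / t powr \<gamma>)) \<le> f t) \<longrightarrow>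
        ennreal (a * b * (r powr (s / \<gamma>) / vol M \<rho> x r))
          \<le> (\<integral>\<^sup>+t. ennreal (f t / t powr (1 - s)) \<partial>lebesgue_on {0<..})"
      by (rule nn_integral_scaled_bound_ge[OF assms(1) hom dims meas(2) nonneg(2) pos])
    have "ennreal (c * b / Gamma s * (\<rho> x y powr (s / \<gamma>) / vol M \<rho> x (\<rho> x y))) \<le> K x y"
      if xy: "x \<in> space M" "y \<in> space M" "x \<noteq> y" for x y
    proof -
      have "ennreal (c * b / Gamma s * (\<rho> x y powr (s / \<gamma>) / vol M \<rho> x (\<rho> x y)))
          = ennreal (1 / Gamma s) * ennreal (c * b * (\<rho> x y powr (s / \<gamma>) / vol M \<rho> x (\<rho> x y)))"
        using G by (simp add: ennreal_mult'[symmetric] mult_ac)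
      also have "\<dots> \<le> K x y"
        unfolding assms(10) frac_kernel_lebesgue_on
        using c xy \<rho>_pos by (intro mult_left_mono b(2)[rule_format]) auto
      finally show ?thesis .
    qed
    moreover have "c * b / Gamma s > 0" using b(1) c(1) G by simp
    ultimately show "\<exists>c>0. \<forall>x\<in>space M. \<forall>y\<in>space M. x \<noteq> y \<longrightarrow>
        K x y \<ge> ennreal (c * (\<rho> x y powr (s / \<gamma>) / vol M \<rho> x (\<rho> x y)))" by blast
  next
    assume "(\<exists>C>0. \<forall>x\<in>space M. \<forall>x'\<in>space M. \<forall>y\<in>space M. \<forall>t>0. \<rho> x x' < inverse (2 * A\<^sub>0) * \<rho> x y \<longrightarrow>
          \<bar>p t x y - p t x' y\<bar> + \<bar>p t y x - p t y x'\<bar>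
            \<le> C * (1 / vol M \<rho> x (t powr \<gamma>) * (\<rho> x x' / t powr \<gamma>) powr \<epsilon>
                    * \<Phi>\<^sub>3 (\<rho> x y / t powr \<gamma>))) \<and>
      (\<integral>\<^sup>+w\<in>{0<..1}. ennreal (\<Phi>\<^sub>3 w * w powr (d + \<epsilon> - s / \<gamma>) / w) \<partial>lebesgue)
        + (\<integral>\<^sup>+w\<in>{1..}. ennreal (\<Phi>\<^sub>3 w * w powr (D + \<epsilon> - s / \<gamma>) / w) \<partial>lebesgue) < \<infinity>"
    then obtain C where C: "C > 0" "\<And>x x' y t. x \<in> space M \<Longrightarrow> x' \<in> space M \<Longrightarrow> y \<in> space M \<Longrightarrow> t > 0 \<Longrightarrow>
          \<rho> x x' < inverse (2 * A\<^sub>0) * \<rho> x y \<Longrightarrow>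
          \<bar>p t x y - p t x' y\<bar> + \<bar>p t y x - p t y x'\<bar>
            \<le> C * (1 / vol M \<rho> x (t powr \<gamma>) * (\<rho> x x' / t powr \<gamma>) powr \<epsilon> * \<Phi>\<^sub>3 (\<rho> x y / t powr \<gamma>))"
      and fin3: "(\<integral>\<^sup>+w\<in>{0<..1}. ennreal (\<Phi>\<^sub>3 w * w powr (d + \<epsilon> - s / \<gamma>) / w) \<partial>lebesgue)
        + (\<integral>\<^sup>+w\<in>{1..}. ennreal (\<Phi>\<^sub>3 w * w powr (D + \<epsilon> - s / \<gamma>) / w) \<partial>lebesgue) < \<infinity>"
      by blast
    define \<Psi> where "\<Psi> = (\<lambda>w. \<Phi>\<^sub>3 w * w powr \<epsilon>)"
    have \<Psi>_meas: "\<Psi> \<in> borel_measurable (lebesgue_on {0<..})"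
      unfolding \<Psi>_def by (intro borel_measurable_times meas(3)) measurable
    have \<Psi>_nonneg: "\<And>w. w > 0 \<Longrightarrow> 0 \<le> \<Psi> w"
      using nonneg(3) by (simp add: \<Psi>_def)
    have \<Psi>_powr: "\<Psi> w * w powr (q - s / \<gamma>) = \<Phi>\<^sub>3 w * w powr (q + \<epsilon> - s / \<gamma>)" for w q
      using powr_add[of w \<epsilon> "q - s / \<gamma>"] by (simp add: \<Psi>_def algebra_simps)
    obtain B where B: "B > 0" "\<forall>x\<in>space M. \<forall>r>0. \<forall>a\<ge>0. \<forall>f.
        (\<forall>t>0. f t \<le> a * (1 / vol M \<rho> x (t powr \<gamma>) * \<Psi> (r / t powr \<gamma>))) \<longrightarrow>
        (\<integral>\<^sup>+t. ennreal (f t / t powr (1 - s)) \<partial>lebesgue_on {0<..})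
          \<le> ennreal (a * B * (r powr (s / \<gamma>) / vol M \<rho> x r))"
      by (rule nn_integral_scaled_bound_le[OF assms(1) hom dims \<Psi>_meas \<Psi>_nonneg fin3[folded \<Psi>_powr]])
    have "\<bar>enn2real (K x y) - enn2real (K x' y)\<bar> + \<bar>enn2real (K y x) - enn2real (K y x')\<bar>
        \<le> 2 * C * B / Gamma s * (\<rho> x y powr (s / \<gamma>) / vol M \<rho> x (\<rho> x y) * (\<rho> x x' / \<rho> x y) powr \<epsilon>)"
      if sp: "x \<in> space M" "x' \<in> space M" "y \<in> space M"
        and near: "\<rho> x x' < inverse (2 * A\<^sub>0) * \<rho> x y"
        and fin: "K x y < \<infinity> \<and> K x' y < \<infinity> \<and> K y x < \<infinity> \<and> K y x' < \<infinity>" for x x' y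
    proof -
      have "inverse (2 * A\<^sub>0) * \<rho> x y > 0" using near \<rho>_nonneg[OF sp(1,2)] by linarith
      then have r: "\<rho> x y > 0" using A by (simp add: zero_less_mult_iff)
      define a where "a = C * (\<rho> x x' / \<rho> x y) powr \<epsilon>"
      have a: "a \<ge> 0" using C(1) by (simp add: a_def)
      define v where "v = a * B * (\<rho> x y powr (s / \<gamma>) / vol M \<rho> x (\<rho> x y))"
      have v: "v \<ge> 0" using a B(1) by (simp add: v_def vol_def)
      have bound: "\<bar>p t x y - p t x' y\<bar> + \<bar>p t y x - p t y x'\<bar>
          \<le> a * (1 / vol M \<rho> x (t powr \<gamma>) * \<Psi> (\<rho> x y / t powr \<gamma>))" if t: "t > 0" for t
      proof -
        have "(\<rho> x x' / t powr \<gamma>) powr \<epsilon> = ((\<rho> x x' / \<rho> x y) * (\<rho> x y / t powr \<gamma>)) powr \<epsilon>"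
          using r by simp
        also have "\<dots> = (\<rho> x x' / \<rho> x y) powr \<epsilon> * (\<rho> x y / t powr \<gamma>) powr \<epsilon>"
          by (rule powr_mult)
        finally show ?thesis
          using C(2)[OF sp t near] by (simp add: a_def \<Psi>_def mult_ac)
      qed
      have le: "(\<integral>\<^sup>+t. ennreal (\<bar>p t x y - p t x' y\<bar> / t powr (1 - s)) \<partial>lebesgue_on {0<..}) \<le> ennreal v"
        "(\<integral>\<^sup>+t. ennreal (\<bar>p t y x - p t y x'\<bar> / t powr (1 - s)) \<partial>lebesgue_on {0<..}) \<le> ennreal v"
        unfolding v_def by (intro B(2)[rule_format] sp r a order_trans[OF _ bound]; simp)+
      have "\<bar>enn2real (K x y) - enn2real (K x' y)\<bar> + \<bar>enn2real (K y x) - enn2real (K y x')\<bar>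
          \<le> v / Gamma s + v / Gamma s"
        unfolding assms(10) using assms(2,9) sp fin[unfolded assms(10)] v
        by (intro add_mono frac_kernel_diff_le le) simp_all
      also have "\<dots> = 2 * C * B / Gamma s
          * (\<rho> x y powr (s / \<gamma>) / vol M \<rho> x (\<rho> x y) * (\<rho> x x' / \<rho> x y) powr \<epsilon>)"
        by (simp add: v_def a_def)
      finally show ?thesis .
    qed
    moreover have "2 * C * B / Gamma s > 0" using B(1) C(1) G by simp
    ultimately show "\<exists>C>0. \<forall>x\<in>space M. \<forall>x'\<in>space M. \<forall>y\<in>space M. \<rho> x x' < inverse (2 * A\<^sub>0) * \<rho> x y \<longrightarrow>
          K x y < \<infinity> \<and> K x' y < \<infinity> \<and> K y x < \<infinity> \<and> K y x' < \<infinity> \<longrightarrow>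
          \<bar>enn2real (K x y) - enn2real (K x' y)\<bar> + \<bar>enn2real (K y x) - enn2real (K y x')\<bar>
            \<le> C * (\<rho> x y powr (s / \<gamma>) / vol M \<rho> x (\<rho> x y) * (\<rho> x x' / \<rho> x y) powr \<epsilon>)"
      by blast
  }
qed

end
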